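(* Let $\mathcal{S}$ be an addable abstract numeration system, let $\mathbf{x}$ be an $\mathcal{S}$-automatic infinite word over a finite alphabet, and let $X$ be the subshift generated by $\mathbf{x}$. Then the winning shift $W(X)$ is weakly $\mathcal{S}$-codable.
   Context: Subshifts are one-sided: closed shift-invariant subsets of $A^{\mathbb{N}}$; the subshift generated by $\mathbf{x}$ is its orbit closure. Winning shift: for $X\subseteq A^{\mathbb{N}}$ and a choice sequence $\alpha=\alpha_0\alpha_1\cdots\in\{0,\dots,|A|-1\}^{\mathbb{N}}$, Alice and Bob play infinitely many rounds; in round $j$ Alice chooses $A_j\subseteq A$ with $|A_j|=\alpha_j+1$ and Bob chooses $a_j\in A_j$; Alice wins if $a_0a_1\cdots\in X$. $W(X)$ is the set of $\alpha$ for which Alice has a winning strategy (a subset of $\mathbb{N}^{\mathbb{N}}$). ANS: $\mathcal{S}=(L,\prec)$ with $L$ an infinite language and $\prec$ a total order on $L$ of order type $\omega$; $\mathrm{rep}(n)$ is the $n$-th word of $L$, $\mathrm{val}=\mathrm{rep}^{-1}$; tuples in $\mathbb{N}^d$ are represented by left-padding the component representations with a new symbol $\#$ to equal length. $Y\subseteq\mathbb{N}^d$ is $\mathcal{S}$-recognizable if $\mathrm{rep}(Y)$ is regular. $\mathcal{S}$ is addable if $\{(x,y,x+y)\}$ is $\mathcal{S}$-recognizable. $\mathbf{x}$ is $\mathcal{S}$-automatic if some DFA with output outputs $\mathbf{x}[n]$ on input $\mathrm{rep}(n)$ for all $n\ge0$. Codability: for $\mathbf{y}\in\mathbb{N}^{\mathbb{N}}$,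 $\sum\mathbf{y}=\sum_iy_i$; if $\sum\mathbf{y}=d<\infty$, $\nu(\mathbf{y})$ is the unique nondecreasing $(n_1,\dots,n_d)$ with $y_j=|\{k:n_k=j\}|$ for all $j$. $Y\subseteq\mathbb{N}^{\mathbb{N}}$ is weakly $\mathcal{S}$-codable if for each $k\in\mathbb{N}$ the set $\{\nu(\mathbf{y}):\mathbf{y}\in Y,\sum\mathbf{y}\le k\}$ is $\mathcal{S}$-recognizable (i.e. its intersection with each $\mathbb{N}^i$, $i\le k$, is). *)

theory Defs
  imports Main "HOL-Library.Multiset" "HOL-Library.Extended_Nat"
begin

definition regular :: "'b set \<Rightarrow> 'b list set \<Rightarrow> bool" where
  "regular \<Sigma> K \<longleftrightarrow> K \<subseteq> lists \<Sigma> \<and>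
     (\<exists>(Q::nat set) q0 \<delta> F. finite Q \<and> q0 \<in> Q \<and> (\<forall>q\<in>Q. \<forall>a\<in>\<Sigma>. \<delta> q a \<in> Q) \<and> F \<subseteq> Q \<and>
        K = {w \<in> lists \<Sigma>. foldl \<delta> q0 w \<in> F})"

text \<open>An ANS over the finite alphabet Sigma: an infinite language L over Sigma with a
  strict total order on L of order type omega (every word has finitely many predecessors).\<close>
definition ANS :: "'a set \<Rightarrow> 'a list set \<Rightarrow> ('a list \<Rightarrow> 'a list \<Rightarrow> bool) \<Rightarrow> bool" where
  "ANS \<Sigma> L prec \<longleftrightarrow> finite \<Sigma> \<and> L \<subseteq> lists \<Sigma> \<and> infinite L \<and>
     (\<forall>u\<in>L. \<not> prec u u) \<and>
     (\<forall>u\<in>L. \<forall>v\<in>L. \<forall>w\<in>L. prec u v \<longrightarrow> prec v w \<longrightarrow> prec u w) \<and>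
     (\<forall>u\<in>L. \<forall>v\<in>L. u \<noteq> v \<longrightarrow> prec u v \<or> prec v u) \<and>
     (\<forall>w\<in>L. finite {v\<in>L. prec v w})"

definition rep :: "'a list set \<Rightarrow> ('a list \<Rightarrow> 'a list \<Rightarrow> bool) \<Rightarrow> nat \<Rightarrow> 'a list" where
  "rep L prec n = (THE w. w \<in> L \<and> card {v\<in>L. prec v w} = n)"

text \<open>Padding with the new symbol # (rendered as None).\<close>
definition pad :: "nat \<Rightarrow> 'a list \<Rightarrow> 'a option list" where
  "pad m w = replicate (m - length w) None @ map Some w"

definition rep_tuple :: "'a list set \<Rightarrow> ('a list \<Rightarrow> 'a list \<Rightarrow> bool) \<Rightarrow> nat list \<Rightarrow> 'a option list list" where
  "rep_tuple L prec ns =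
     (let ws = map (rep L prec) ns; m = foldr max (map length ws) 0
      in map (\<lambda>i. map (\<lambda>w. pad m w ! i) ws) [0..<m])"

definition tuple_alph :: "'a set \<Rightarrow> nat \<Rightarrow> 'a option list set" where
  "tuple_alph \<Sigma> d = {c. length c = d \<and> set c \<subseteq> Some ` \<Sigma> \<union> {None}}"

definition recognizable ::
  "'a set \<Rightarrow> 'a list set \<Rightarrow> ('a list \<Rightarrow> 'a list \<Rightarrow> bool) \<Rightarrow> nat \<Rightarrow> nat list set \<Rightarrow> bool" where
  "recognizable \<Sigma> L prec d Y \<longleftrightarrow> Y \<subseteq> {ns. length ns = d} \<and>
     regular (tuple_alph \<Sigma> d) (rep_tuple L prec ` Y)"

definition addable :: "'a set \<Rightarrow> 'a list set \<Rightarrow> ('a list \<Rightarrow> 'a list \<Rightarrow> bool) \<Rightarrow> bool" where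
  "addable \<Sigma> L prec \<longleftrightarrow> recognizable \<Sigma> L prec 3 {[x, y, x + y] | x y. True}"

definition automatic ::
  "'a set \<Rightarrow> 'a list set \<Rightarrow> ('a list \<Rightarrow> 'a list \<Rightarrow> bool) \<Rightarrow> (nat \<Rightarrow> 'b) \<Rightarrow> bool" where
  "automatic \<Sigma> L prec x \<longleftrightarrow>
     (\<exists>(Q::nat set) q0 \<delta> (\<tau>::nat \<Rightarrow> 'b). finite Q \<and> q0 \<in> Q \<and> (\<forall>q\<in>Q. \<forall>a\<in>\<Sigma>. \<delta> q a \<in> Q) \<and>
        (\<forall>n. x n = \<tau> (foldl \<delta> q0 (rep L prec n))))"

text \<open>Orbit closure of x in A^N (product of discrete topologies): y lies in it iff every
  prefix of y occurs in x.\<close>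
definition subshift_gen :: "'b set \<Rightarrow> (nat \<Rightarrow> 'b) \<Rightarrow> (nat \<Rightarrow> 'b) set" where
  "subshift_gen A x = {y. (\<forall>n. y n \<in> A) \<and> (\<forall>n. \<exists>k. \<forall>i<n. y i = x (k + i))}"

text \<open>Alice's strategy maps the history of Bob's moves a_0...a_{j-1} to the set A_j.\<close>
definition winning_shift :: "'b set \<Rightarrow> (nat \<Rightarrow> 'b) set \<Rightarrow> (nat \<Rightarrow> nat) set" where
  "winning_shift A X = {\<alpha>. (\<forall>j. \<alpha> j < card A) \<and>
     (\<exists>\<sigma> :: 'b list \<Rightarrow> 'b set.
        (\<forall>h. \<sigma> h \<subseteq> A \<and> card (\<sigma> h) = \<alpha> (length h) + 1) \<and>
        (\<forall>b. (\<forall>j. b j \<in> \<sigma> (map b [0..<j])) \<longrightarrow> b \<in> X))}"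

definition seq_sum :: "(nat \<Rightarrow> nat) \<Rightarrow> enat" where
  "seq_sum y = (if finite {j. y j \<noteq> 0} then enat (\<Sum>j\<in>{j. y j \<noteq> 0}. y j) else \<infinity>)"

definition nu :: "(nat \<Rightarrow> nat) \<Rightarrow> nat list" where
  "nu y = (THE ns. sorted ns \<and> (\<forall>j. count (mset ns) j = y j))"

definition weakly_codable ::
  "'a set \<Rightarrow> 'a list set \<Rightarrow> ('a list \<Rightarrow> 'a list \<Rightarrow> bool) \<Rightarrow> (nat \<Rightarrow> nat) set \<Rightarrow> bool" where
  "weakly_codable \<Sigma> L prec Y \<longleftrightarrow>
     (\<forall>k i. i \<le> k \<longrightarrow>
        recognizable \<Sigma> L prec i ({nu y | y. y \<in> Y \<and> seq_sum y \<le> enat k} \<inter> {ns. length ns = i}))"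

end

theory Submission
  imports Defs
begin

text \<open>If Alice wins for a choice sequence of finite sum \<open>d\<close>, her strategy is a tree with at most
  \<open>2 ^ d\<close> branches. Up to the last real choice each branch is a factor of the word, and from then
  on it may be continued as in the word. So the strategy is encoded by at most \<open>2 ^ d\<close> positions,
  and winning is expressed by a first-order formula over addition and the letters of the word.
  Predicates defined by such formulas are recognizable; automata are replaced by the finiteness
  of the set of residuals, which makes the closure properties independent of state spaces.\<close>

section \<open>Languages with finitely many residuals\<close>

text \<open>A strategy is a second-order object. It reduces to finitely many numbers because
  membership in the orbit closure only tests prefixes: after the last real choice Alice may offer
  singletons that follow the word. The number of positions depends on \<open>d\<close> alone, not on
  where the choices occur, but it grows with \<open>d\<close>; so there is one formula for each
  tuple length, which is what weak codability asks for. Two obstacles shape the encoding. The order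
  \<open>prec\<close> is not tied to word length, so no width is known in advance that accommodates
  a quantified witness. And \<open>ANS\<close> does not say that \<open>L\<close> is regular, yet a
  quantifier must recognize which guessed tracks are representations; this is extracted from
  addability. Residuals also make sense over the infinite alphabet of functions from variables to
  symbols. Automata return only at the interface with \<open>regular\<close>.\<close>

definition finite_residuals :: "'c list set \<Rightarrow> bool" where
  "finite_residuals K \<longleftrightarrow> finite (range (\<lambda>u. {v. u @ v \<in> K}))"

lemma finite_residualsI:
  assumes "finite S" and "\<And>u. {v. u @ v \<in> K} \<in> S"
  shows "finite_residuals K"
  unfolding finite_residuals_def using assms by (meson finite_subset image_subsetI)

lemma finite_residuals_Compl:
  assumes "finite_residuals K"
  shows "finite_residuals (- K)"
proof (rule finite_residualsI)
  show "finite (uminus ` range (\<lambda>u. {v. u @ v \<in> K}))"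
    using assms unfolding finite_residuals_def by simp
  show "{v. u @ v \<in> - K} \<in> uminus ` range (\<lambda>u. {v. u @ v \<in> K})" for u
    by (rule image_eqI[of _ _ "{v. u @ v \<in> K}"]) auto
qed

lemma finite_residuals_Int:
  assumes "finite_residuals K" and "finite_residuals K'"
  shows "finite_residuals (K \<inter> K')"
proof (rule finite_residualsI)
  let ?S = "(\<lambda>(R, R'). R \<inter> R') ` (range (\<lambda>u. {v. u @ v \<in> K}) \<times> range (\<lambda>u. {v. u @ v \<in> K'}))"
  show "finite ?S"
    using assms unfolding finite_residuals_def by blast
  show "{v. u @ v \<in> K \<inter> K'} \<in> ?S" for u
    by (rule image_eqI[of _ _ "({v. u @ v \<in> K}, {v. u @ v \<in> K'})"]) auto
qed

lemma finite_residuals_UNIV: "finite_residuals UNIV"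
  by (rule finite_residualsI[of "{UNIV}"]) auto

lemma finite_residuals_INT:
  assumes "finite I" and "\<And>i. i \<in> I \<Longrightarrow> finite_residuals (K i)"
  shows "finite_residuals (\<Inter>i\<in>I. K i)"
  using assms by (induction I) (auto simp: finite_residuals_UNIV intro: finite_residuals_Int)

lemma finite_residuals_lists: "finite_residuals (lists \<Sigma>)"
  by (rule finite_residualsI[of "{lists \<Sigma>, {}}"]) auto

text \<open>Used with \<open>c\<close> the all-blank column: the absence of such a column in front
  separates \<open>rep_tuple\<close> from wider paddings of the same tuple.\<close>

lemma finite_residuals_hd_neq: "finite_residuals {w. w = [] \<or> hd w \<noteq> c}"
proof (rule finite_residualsI)
  show "finite {{w. w = [] \<or> hd w \<noteq> c}, UNIV, {}}" by simp
  show "{v. u @ v \<in> {w. w = [] \<or> hd w \<noteq> c}} \<in> {{w. w = [] \<or> hd w \<noteq> c}, UNIV, {}}" for u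
    by (cases u) auto
qed

lemma finite_residuals_vimage_map:
  assumes "finite_residuals K"
  shows "finite_residuals {w. map h w \<in> K}"
proof (rule finite_residualsI)
  show "finite ((\<lambda>R. {v. map h v \<in> R}) ` range (\<lambda>u. {v. u @ v \<in> K}))"
    using assms unfolding finite_residuals_def by simp
  show "{v. u @ v \<in> {w. map h w \<in> K}} \<in> (\<lambda>R. {v. map h v \<in> R}) ` range (\<lambda>u. {v. u @ v \<in> K})" for u
    by (rule image_eqI[of _ _ "{v. map h u @ v \<in> K}"]) auto
qed

text \<open>The subset construction: the residual at \<open>u\<close> is determined by the set of
  residuals of \<open>K\<close> at the preimages of \<open>u\<close>. Fibres of \<open>h\<close> may
  be infinite, but there are only finitely many sets of residuals.\<close>

lemma finite_residuals_image_map: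
  assumes "finite_residuals K"
  shows "finite_residuals (map h ` K)"
proof (rule finite_residualsI)
  let ?S = "(\<lambda>\<R>. map h ` \<Union>\<R>) ` Pow (range (\<lambda>u. {v. u @ v \<in> K}))"
  show "finite ?S"
    using assms unfolding finite_residuals_def by simp
  show "{v. u @ v \<in> map h ` K} \<in> ?S" for u
  proof (rule image_eqI)
    let ?\<R> = "(\<lambda>u'. {v. u' @ v \<in> K}) ` {u'. map h u' = u}"
    show "{v. u @ v \<in> map h ` K} = map h ` \<Union>?\<R>"
    proof (intro equalityI subsetI)
      fix v assume "v \<in> {v. u @ v \<in> map h ` K}"
      then obtain w where w: "w \<in> K" "u @ v = map h w" by auto
      then obtain u' v' where "w = u' @ v'" "map h u' = u" "map h v' = v"
        by (metis append_eq_map_conv)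
      with w show "v \<in> map h ` \<Union>?\<R>" by auto
    next
      fix v assume "v \<in> map h ` \<Union>?\<R>"
      then obtain u' v' where "map h u' = u" "map h v' = v" "u' @ v' \<in> K" by auto
      then show "v \<in> {v. u @ v \<in> map h ` K}" by (auto intro!: image_eqI[of _ _ "u' @ v'"])
    qed
    show "?\<R> \<in> Pow (range (\<lambda>u. {v. u @ v \<in> K}))" by auto
  qed
qed

lemma finite_residuals_strip:
  assumes "finite_residuals K"
  shows "finite_residuals {w. \<exists>k. replicate k c @ w \<in> K}"
proof (rule finite_residualsI)
  let ?S = "Union ` Pow (range (\<lambda>u. {v. u @ v \<in> K}))"
  show "finite ?S"
    using assms unfolding finite_residuals_def by simp
  show "{v. u @ v \<in> {w. \<exists>k. replicate k c @ w \<in> K}} \<in> ?S" for u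
  proof (rule image_eqI)
    let ?\<R> = "range (\<lambda>k. {v. (replicate k c @ u) @ v \<in> K})"
    show "{v. u @ v \<in> {w. \<exists>k. replicate k c @ w \<in> K}} = \<Union>?\<R>" by auto
    show "?\<R> \<in> Pow (range (\<lambda>u. {v. u @ v \<in> K}))" by blast
  qed
qed

text \<open>After \<open>u\<close>, either the padding is still running, which forces
  \<open>u\<close> to be a power of \<open>c\<close> and leaves \<open>?P\<close> again, or it ended
  inside \<open>u\<close> and a residual of \<open>K\<close> remains. Both can happen for the same
  \<open>u\<close>, hence the union.\<close>

lemma finite_residuals_pad:
  assumes "finite_residuals K"
  shows "finite_residuals {replicate k c @ w | k w. w \<in> K}" (is "finite_residuals ?P")
proof (rule finite_residualsI)
  let ?S = "(\<lambda>(R, \<R>). R \<union> \<Union>\<R>) ` ({?P, {}} \<times> Pow (range (\<lambda>u. {v. u @ v \<in> K})))"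
  show "finite ?S"
    using assms unfolding finite_residuals_def by simp
  show "{v. u @ v \<in> ?P} \<in> ?S" for u
  proof (rule image_eqI)
    let ?R = "if \<exists>j. u = replicate j c then ?P else {}"
    let ?\<R> = "(\<lambda>u'. {v. u' @ v \<in> K}) ` {u'. \<exists>k. u = replicate k c @ u'}"
    have "{v. u @ v \<in> ?P} = ?R \<union> \<Union>?\<R>"
    proof (intro equalityI subsetI)
      fix v assume "v \<in> {v. u @ v \<in> ?P}"
      then obtain k w where w: "w \<in> K" "u @ v = replicate k c @ w" by auto
      then consider t where "u = replicate k c @ t" "t @ v = w"
        | t where "u @ t = replicate k c" "v = t @ w"
        by (auto simp: append_eq_append_conv2)
      then show "v \<in> ?R \<union> \<Union>?\<R>"
      proof cases
        case 1
        with w show ?thesis by auto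
      next
        case 2
        from 2(1)[symmetric] obtain j l where "u = replicate j c" "t = replicate l c"
          by (metis replicate_eqI in_set_replicate set_append Un_iff)
        with 2 w show ?thesis by auto
      qed
    next
      fix v assume "v \<in> ?R \<union> \<Union>?\<R>"
      then consider j k w where "u = replicate j c" "v = replicate k c @ w" "w \<in> K"
        | u' k where "u = replicate k c @ u'" "u' @ v \<in> K"
        by (auto split: if_splits)
      then show "v \<in> {v. u @ v \<in> ?P}"
      proof cases
        case 1
        then have "u @ v = replicate (j + k) c @ w" by (simp add: replicate_add)
        with 1 show ?thesis by blast
      next
        case 2
        then show ?thesis by auto
      qed
    qed
    then show "{v. u @ v \<in> ?P} = (\<lambda>(R, \<R>). R \<union> \<Union>\<R>) (?R, ?\<R>)" by simp
    show "(?R, ?\<R>) \<in> {?P, {}} \<times> Pow (range (\<lambda>u. {v. u @ v \<in> K}))" by auto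
  qed
qed

lemma foldl_closed:
  assumes "\<forall>q\<in>Q. \<forall>a\<in>\<Sigma>. \<delta> q a \<in> Q" and "q \<in> Q" and "w \<in> lists \<Sigma>"
  shows "foldl \<delta> q w \<in> Q"
  using assms by (induction w arbitrary: q) auto

text \<open>A residual depends only on the state reached, and is empty once a letter outside
  \<open>\<Sigma>\<close> was read. Acceptance is an arbitrary \<open>P\<close> so that automata
  with output are covered too.\<close>

lemma finite_residuals_automaton:
  assumes "finite Q" and "q0 \<in> Q" and "\<forall>q\<in>Q. \<forall>a\<in>\<Sigma>. \<delta> q a \<in> Q"
  shows "finite_residuals {w \<in> lists \<Sigma>. P (foldl \<delta> q0 w)}"
proof (rule finite_residualsI)
  let ?S = "insert {} ((\<lambda>q. {v \<in> lists \<Sigma>. P (foldl \<delta> q v)}) ` Q)"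
  show "finite ?S" using assms(1) by simp
  show "{v. u @ v \<in> {w \<in> lists \<Sigma>. P (foldl \<delta> q0 w)}} \<in> ?S" for u
  proof (cases "u \<in> lists \<Sigma>")
    case True
    then have "foldl \<delta> q0 u \<in> Q" using foldl_closed assms by metis
    moreover have "{v. u @ v \<in> {w \<in> lists \<Sigma>. P (foldl \<delta> q0 w)}}
        = {v \<in> lists \<Sigma>. P (foldl \<delta> (foldl \<delta> q0 u) v)}"
      using True by auto
    ultimately show ?thesis by auto
  qed auto
qed

lemma regular_imp_finite_residuals: "regular \<Sigma> K \<Longrightarrow> finite_residuals K"
  unfolding regular_def using finite_residuals_automaton[where P = "\<lambda>q. q \<in> F" for F] by metis

text \<open>Myhill-Nerode: the residuals are the states. The injection \<open>f\<close> merely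
  numbers them, because \<open>regular\<close> asks for states in \<open>nat\<close>.\<close>

lemma finite_residuals_imp_regular:
  assumes "finite_residuals K" and "K \<subseteq> lists \<Sigma>"
  shows "regular \<Sigma> K"
proof -
  let ?R = "range (\<lambda>u. {v. u @ v \<in> K})"
  have "finite ?R" using assms(1) unfolding finite_residuals_def .
  then obtain f :: "'a list set \<Rightarrow> nat" where f: "inj_on f ?R"
    using finite_imp_inj_to_nat_seg by metis
  define g where "g = inv_into ?R f"
  define \<delta> where "\<delta> q a = f {v. a # v \<in> g q}" for q a
  let ?Q = "f ` ?R"
  have gf: "g (f {v. u @ v \<in> K}) = {v. u @ v \<in> K}" for u
    unfolding g_def using f by simp
  have step: "\<delta> (f {v. u @ v \<in> K}) a = f {v. (u @ [a]) @ v \<in> K}" for u a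
    unfolding \<delta>_def gf by simp
  have run: "foldl \<delta> (f {v. [] @ v \<in> K}) w = f {v. w @ v \<in> K}" for w
    by (induction w rule: rev_induct) (simp_all add: step[simplified])
  have "finite ?Q" using \<open>finite ?R\<close> by simp
  moreover have "f {v. [] @ v \<in> K} \<in> ?Q" by blast
  moreover have "\<forall>q\<in>?Q. \<forall>a\<in>\<Sigma>. \<delta> q a \<in> ?Q" using step by blast
  moreover have "{q \<in> ?Q. [] \<in> g q} \<subseteq> ?Q" by blast
  moreover have "K = {w \<in> lists \<Sigma>. foldl \<delta> (f {v. [] @ v \<in> K}) w \<in> {q \<in> ?Q. [] \<in> g q}}"
    unfolding run using assms(2) gf by auto
  ultimately show ?thesis unfolding regular_def using assms(2) by blast
qed


section \<open>Definable predicates on environments\<close>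

lemma length_pad [simp]: "length w \<le> m \<Longrightarrow> length (pad m w) = m"
  by (simp add: pad_def)

lemma replicate_append_pad:
  "length w \<le> m \<Longrightarrow> replicate k None @ pad m w = pad (k + m) w"
  by (simp add: pad_def flip: replicate_add)

lemma filter_pad: "filter (\<lambda>z. z \<noteq> None) (pad m w) = map Some w"
  by (simp add: pad_def filter_replicate)

lemma pad_nth_None: "length w \<le> m \<Longrightarrow> 0 < m \<Longrightarrow> pad m w ! 0 = None \<Longrightarrow> length w \<le> m - 1"
  by (cases "length w = m") (auto simp: pad_def nth_append)

definition padded :: "(nat \<Rightarrow> 'a list) \<Rightarrow> nat set \<Rightarrow> 'a option list set" where
  "padded r N = {replicate k None @ map Some (r n) | k n. n \<in> N}"

lemma pad_in_padded_iff: "inj r \<Longrightarrow> pad m (r n) \<in> padded r N \<longleftrightarrow> n \<in> N"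
proof
  assume "inj r" "pad m (r n) \<in> padded r N"
  then obtain k n' where n': "n' \<in> N" "pad m (r n) = replicate k None @ map Some (r n')"
    unfolding padded_def by auto
  have "map Some (r n) = filter (\<lambda>z. z \<noteq> None) (pad m (r n))" by (simp only: filter_pad)
  also have "\<dots> = map Some (r n')" unfolding n' by (simp add: filter_replicate)
  finally show "n \<in> N" using n' \<open>inj r\<close> by (simp add: inj_eq)
qed (auto simp: padded_def pad_def)

lemma padded_eq_pad:
  assumes "w \<in> padded r N"
  obtains n where "n \<in> N" and "w = pad (length w) (r n)" and "length (r n) \<le> length w"
  using assms unfolding padded_def pad_def by auto

text \<open>The width \<open>m\<close> is a parameter rather than the maximal length, so that one
  environment can be encoded at several widths when witnesses need more room.\<close>

definition enc :: "(nat \<Rightarrow> 'a list) \<Rightarrow> nat \<Rightarrow> (nat \<Rightarrow> nat) \<Rightarrow> (nat \<Rightarrow> 'a option) list" where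
  "enc r m e = map (\<lambda>j v. pad m (r (e v)) ! j) [0..<m]"

lemma track_enc [simp]:
  "length (r (e v)) \<le> m \<Longrightarrow> map (\<lambda>c. c v) (enc r m e) = pad m (r (e v))"
  by (auto simp: enc_def intro!: nth_equalityI)

lemma length_enc [simp]: "length (enc r m e) = m"
  by (simp add: enc_def)

lemma tracks_ext:
  assumes "\<And>v. map (\<lambda>c. c v) u = map (\<lambda>c. c v) w"
  shows "u = w"
proof (rule nth_equalityI)
  show len: "length u = length w" using assms map_eq_imp_length_eq by blast
  show "u ! i = w ! i" if "i < length u" for i
    using assms that len by (metis ext nth_map)
qed

text \<open>There is one track for every variable, so that no arities have to be tracked. The bound
  on the representations restricts attention to environments of finite range.\<close>

definition definable :: "(nat \<Rightarrow> 'a list) \<Rightarrow> ((nat \<Rightarrow> nat) \<Rightarrow> bool) \<Rightarrow> bool" where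
  "definable r P \<longleftrightarrow> (\<exists>K. finite_residuals K \<and>
     (\<forall>e m. (\<forall>v. length (r (e v)) \<le> m) \<longrightarrow> (enc r m e \<in> K \<longleftrightarrow> P e)))"

lemma definable_not:
  assumes "definable r P"
  shows "definable r (\<lambda>e. \<not> P e)"
proof -
  obtain K where "finite_residuals K"
    "\<And>e m. (\<forall>v. length (r (e v)) \<le> m) \<Longrightarrow> (enc r m e \<in> K \<longleftrightarrow> P e)"
    using assms unfolding definable_def by blast
  then show ?thesis
    unfolding definable_def by (intro exI[of _ "- K"]) (simp add: finite_residuals_Compl)
qed

lemma definable_ball:
  assumes "finite I" and "\<And>i. i \<in> I \<Longrightarrow> definable r (P i)"
  shows "definable r (\<lambda>e. \<forall>i\<in>I. P i e)"
proof -
  obtain K where "\<And>i. i \<in> I \<Longrightarrow> finite_residuals (K i)"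
    "\<And>i e m. i \<in> I \<Longrightarrow> (\<forall>v. length (r (e v)) \<le> m) \<Longrightarrow> (enc r m e \<in> K i \<longleftrightarrow> P i e)"
    using assms(2) unfolding definable_def by metis
  then show ?thesis
    unfolding definable_def using assms(1)
    by (intro exI[of _ "\<Inter>i\<in>I. K i"]) (auto intro: finite_residuals_INT)
qed

lemma definable_bex:
  assumes "finite I" and "\<And>i. i \<in> I \<Longrightarrow> definable r (P i)"
  shows "definable r (\<lambda>e. \<exists>i\<in>I. P i e)"
  using definable_not[OF definable_ball[OF assms(1) definable_not[OF assms(2)]]] by simp

lemma definable_conj:
  assumes "definable r P" and "definable r Q"
  shows "definable r (\<lambda>e. P e \<and> Q e)"
proof -
  have "definable r (\<lambda>e. \<forall>R\<in>{P, Q}. R e)" using assms by (intro definable_ball) auto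
  then show ?thesis by simp
qed

lemma definable_const: "definable r (\<lambda>e. b)"
  unfolding definable_def using finite_residuals_UNIV finite_residuals_Compl[OF finite_residuals_UNIV]
  by (cases b) force+

text \<open>A condition on which of finitely many predicates hold is a finite disjunction over the
  possible sets \<open>J\<close>. This makes comparisons of cardinalities definable.\<close>

lemma definable_finite_info:
  assumes "finite I" and "\<And>i. i \<in> I \<Longrightarrow> definable r (P i)"
  shows "definable r (\<lambda>e. g {i\<in>I. P i e})"
proof -
  have "(\<lambda>e. g {i\<in>I. P i e}) = (\<lambda>e. \<exists>J\<in>Pow I. g J \<and> (\<forall>i\<in>I. if i \<in> J then P i e else \<not> P i e))"
  proof (intro ext iffI)
    fix e assume "g {i\<in>I. P i e}"
    then show "\<exists>J\<in>Pow I. g J \<and> (\<forall>i\<in>I. if i \<in> J then P i e else \<not> P i e)"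
      by (intro bexI[of _ "{i\<in>I. P i e}"]) auto
  next
    fix e assume "\<exists>J\<in>Pow I. g J \<and> (\<forall>i\<in>I. if i \<in> J then P i e else \<not> P i e)"
    then obtain J where J: "J \<subseteq> I" "g J" "\<forall>i\<in>I. if i \<in> J then P i e else \<not> P i e" by auto
    then have "{i\<in>I. P i e} = J" by (auto split: if_splits)
    with J show "g {i\<in>I. P i e}" by simp
  qed
  moreover have "definable r (\<lambda>e. \<exists>J\<in>Pow I. g J \<and> (\<forall>i\<in>I. if i \<in> J then P i e else \<not> P i e))"
  proof (intro definable_bex definable_conj definable_const definable_ball)
    show "definable r (\<lambda>e. if i \<in> J then P i e else \<not> P i e)" if "i \<in> I" for i J
      using assms(2)[OF that] by (cases "i \<in> J") (auto intro: definable_not)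
  qed (use assms(1) in auto)
  ultimately show ?thesis by simp
qed

text \<open>Renaming permutes, copies or drops tracks, which is a letterwise map. Atomic predicates
  therefore need to be treated for fixed variables only.\<close>

lemma definable_rename:
  assumes "definable r P"
  shows "definable r (\<lambda>e. P (\<lambda>v. e (f v)))"
proof -
  obtain K where K: "finite_residuals K"
    "\<And>e m. (\<forall>v. length (r (e v)) \<le> m) \<Longrightarrow> (enc r m e \<in> K \<longleftrightarrow> P e)"
    using assms unfolding definable_def by blast
  have "map (\<lambda>c v. c (f v)) (enc r m e) = enc r m (\<lambda>v. e (f v))" for m e
    by (simp add: enc_def)
  then show ?thesis
    unfolding definable_def using K(2)
    by (intro exI[of _ "{w. map (\<lambda>c v. c (f v)) w \<in> K}"])
      (simp add: finite_residuals_vimage_map[OF K(1)])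
qed

text \<open>The witnesses may have longer representations than the remaining variables, hence the
  leading all-blank columns removed after the projection.\<close>

lemma definable_ex_block:
  assumes "finite V" and "definable r P" and "finite_residuals (padded r UNIV)"
  shows "definable r (\<lambda>e. \<exists>q. P (\<lambda>v. if v \<in> V then q v else e v))"
proof -
  obtain K where K: "finite_residuals K"
    "\<And>e m. (\<And>v. length (r (e v)) \<le> m) \<Longrightarrow> (enc r m e \<in> K \<longleftrightarrow> P e)"
    using assms(2) unfolding definable_def by metis
  define h :: "(nat \<Rightarrow> 'a option) \<Rightarrow> nat \<Rightarrow> 'a option" where
    "h c v = (if v \<in> V then None else c v)" for c v
  \<comment> \<open>Without this constraint a guessed track could hold a word that represents no
    number.\<close>
  define Valid :: "(nat \<Rightarrow> 'a option) list set" where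
    "Valid = (\<Inter>v\<in>V. {w. map (\<lambda>c. c v) w \<in> padded r UNIV})"
  \<comment> \<open>The input is blanked by \<open>h\<close> as well, because the old values of the
    bound variables must not influence acceptance.\<close>
  let ?K = "{w. map h w \<in> {w. \<exists>k. replicate k (\<lambda>_. None) @ w \<in> map h ` (K \<inter> Valid)}}"
  have "finite_residuals Valid"
    unfolding Valid_def by (intro finite_residuals_INT assms(1) finite_residuals_vimage_map assms(3))
  then have "finite_residuals ?K"
    by (intro finite_residuals_vimage_map finite_residuals_strip finite_residuals_image_map
        finite_residuals_Int K(1))
  moreover have "enc r m e \<in> ?K \<longleftrightarrow> (\<exists>q. P (\<lambda>v. if v \<in> V then q v else e v))"
    if e: "\<forall>v. length (r (e v)) \<le> m" for e m
  proof
    assume "enc r m e \<in> ?K"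
    then obtain k where "replicate k (\<lambda>_. None) @ map h (enc r m e) \<in> map h ` (K \<inter> Valid)" by auto
    then obtain u where u: "u \<in> K" "u \<in> Valid"
      "map h u = replicate k (\<lambda>_. None) @ map h (enc r m e)" by (elim imageE IntE) simp
    have len: "length u = k + m" using arg_cong[OF u(3), of length] by simp
    have "\<exists>n. map (\<lambda>c. c v) u = pad (k + m) (r n) \<and> length (r n) \<le> k + m" if "v \<in> V" for v
    proof -
      have "map (\<lambda>c. c v) u \<in> padded r UNIV" using u(2) that unfolding Valid_def by auto
      then show ?thesis by (rule padded_eq_pad) (metis len length_map)
    qed
    then obtain q where q: "\<And>v. v \<in> V \<Longrightarrow> map (\<lambda>c. c v) u = pad (k + m) (r (q v))"
      "\<And>v. v \<in> V \<Longrightarrow> length (r (q v)) \<le> k + m" by metis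
    define e' where "e' v = (if v \<in> V then q v else e v)" for v
    have e': "length (r (e' v)) \<le> k + m" for v
      using e q(2) unfolding e'_def by (auto intro: trans_le_add2)
    have track: "map (\<lambda>c. c v) (enc r (k + m) e') = pad (k + m) (r (e' v))" for v
      using e' by simp
    have "u = enc r (k + m) e'"
    proof (rule tracks_ext)
      fix v
      show "map (\<lambda>c. c v) u = map (\<lambda>c. c v) (enc r (k + m) e')"
      proof (cases "v \<in> V")
        case True
        then show ?thesis using q(1) by (simp add: track e'_def)
      next
        case False
        then have "map (\<lambda>c. c v) u = map (\<lambda>c. c v) (map h u)" by (simp add: h_def)
        also have "\<dots> = replicate k None @ map (\<lambda>c. c v) (enc r m e)"
          unfolding u(3) using False by (simp add: h_def)
        also have "\<dots> = pad (k + m) (r (e' v))"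
          using e False by (simp add: replicate_append_pad e'_def)
        finally show ?thesis by (simp add: track)
      qed
    qed
    then have "P e'" using K(2) e' u(1) by simp
    then show "\<exists>q. P (\<lambda>v. if v \<in> V then q v else e v)" unfolding e'_def by auto
  next
    assume "\<exists>q. P (\<lambda>v. if v \<in> V then q v else e v)"
    then obtain q where q: "P (\<lambda>v. if v \<in> V then q v else e v)" by auto
    define e' where "e' v = (if v \<in> V then q v else e v)" for v
    \<comment> \<open>Any common bound on the witness lengths would do; the sum is one because
      \<open>V\<close> is finite.\<close>
    define k where "k = (\<Sum>v\<in>V. length (r (q v)))"
    have "length (r (q v)) \<le> k" if "v \<in> V" for v
      unfolding k_def using assms(1) that by (meson member_le_sum zero_le)
    then have e': "length (r (e' v)) \<le> k + m" for v
      using e unfolding e'_def by (auto intro: trans_le_add2 trans_le_add1)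
    have track: "map (\<lambda>c. c v) (enc r (k + m) e') = pad (k + m) (r (e' v))" for v
      using e' by simp
    have "P e'" using q unfolding e'_def .
    then have "enc r (k + m) e' \<in> K" using K(2)[of e'] e' by simp
    moreover have "enc r (k + m) e' \<in> Valid"
      unfolding Valid_def by (auto simp: track padded_def pad_def)
    moreover have "map h (enc r (k + m) e') = replicate k (\<lambda>_. None) @ map h (enc r m e)"
    proof (rule tracks_ext)
      fix v
      show "map (\<lambda>c. c v) (map h (enc r (k + m) e'))
          = map (\<lambda>c. c v) (replicate k (\<lambda>_. None) @ map h (enc r m e))"
      proof (cases "v \<in> V")
        case True
        then show ?thesis by (simp add: h_def comp_def map_replicate_const replicate_add)
      next
        case False
        then have "map (\<lambda>c. c v) (map h (enc r (k + m) e')) = pad (k + m) (r (e v))"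
          using track[of v] by (simp add: h_def comp_def e'_def)
        moreover have "map (\<lambda>c. c v) (map h (enc r m e)) = pad m (r (e v))"
          using e False by (simp add: h_def comp_def)
        ultimately show ?thesis using e by (simp add: replicate_append_pad del: map_map)
      qed
    qed
    ultimately have "replicate k (\<lambda>_. None) @ map h (enc r m e) \<in> map h ` (K \<inter> Valid)"
      by (intro image_eqI[of _ _ "enc r (k + m) e'"]) simp_all
    then show "enc r m e \<in> ?K" by blast
  qed
  ultimately show ?thesis unfolding definable_def by blast
qed

lemma definable_ex:
  assumes "definable r P" and "finite_residuals (padded r UNIV)"
  shows "definable r (\<lambda>e. \<exists>n. P (e(v := n)))"
proof -
  have "(\<exists>n. P (e(v := n))) \<longleftrightarrow> (\<exists>q. P (\<lambda>v'. if v' \<in> {v} then q v' else e v'))" for e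
  proof
    assume "\<exists>n. P (e(v := n))"
    then obtain n where n: "P (e(v := n))" by blast
    then show "\<exists>q. P (\<lambda>v'. if v' \<in> {v} then q v' else e v')"
      by (intro exI[of _ "\<lambda>_. n"]) (simp add: fun_upd_def)
  next
    assume "\<exists>q. P (\<lambda>v'. if v' \<in> {v} then q v' else e v')"
    then obtain q where q: "P (\<lambda>v'. if v' \<in> {v} then q v' else e v')" by blast
    moreover have "(\<lambda>v'. if v' \<in> {v} then q v' else e v') = e(v := q v)" by auto
    ultimately show "\<exists>n. P (e(v := n))" by metis
  qed
  then show ?thesis using definable_ex_block[OF _ assms, of "{v}"] by simp
qed

lemma definable_track:
  assumes "inj r" and "finite_residuals (padded r N)"
  shows "definable r (\<lambda>e. e v \<in> N)"
  unfolding definable_def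
  by (intro exI[of _ "{w. map (\<lambda>c. c v) w \<in> padded r N}"])
    (simp add: finite_residuals_vimage_map assms pad_in_padded_iff)


section \<open>Recognizable sets of tuples\<close>

definition columns :: "(nat \<Rightarrow> 'a list) \<Rightarrow> nat \<Rightarrow> nat list \<Rightarrow> 'a option list list" where
  "columns r m ns = map (\<lambda>j. map (\<lambda>n. pad m (r n) ! j) ns) [0..<m]"

definition max_length :: "(nat \<Rightarrow> 'a list) \<Rightarrow> nat list \<Rightarrow> nat" where
  "max_length r ns = foldr max (map (\<lambda>n. length (r n)) ns) 0"

lemma max_length_le_iff: "max_length r ns \<le> m \<longleftrightarrow> (\<forall>n\<in>set ns. length (r n) \<le> m)"
  unfolding max_length_def by (induction ns) auto

lemma rep_tuple_eq_columns:
  "rep_tuple L prec ns = columns (rep L prec) (max_length (rep L prec) ns) ns"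
  by (simp add: rep_tuple_def columns_def max_length_def Let_def comp_def)

lemma length_columns [simp]: "length (columns r m ns) = m"
  by (simp add: columns_def)

lemma length_in_columns: "c \<in> set (columns r m ns) \<Longrightarrow> length c = length ns"
  by (auto simp: columns_def)

lemma row_columns:
  assumes "i < length ns" and "length (r (ns ! i)) \<le> m"
  shows "map (\<lambda>c. c ! i) (columns r m ns) = pad m (r (ns ! i))"
  using assms by (auto simp: columns_def intro!: nth_equalityI)

text \<open>For \<open>d = 0\<close> the rows carry no information about the length, so equality of
  lengths is a separate hypothesis, in contrast to \<open>tracks_ext\<close>.\<close>

lemma rows_ext:
  assumes "length u = length w" and "\<And>c. c \<in> set u \<union> set w \<Longrightarrow> length c = d"
    and "\<And>i. i < d \<Longrightarrow> map (\<lambda>c. c ! i) u = map (\<lambda>c. c ! i) w"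
  shows "u = w"
proof (rule nth_equalityI)
  show "u ! j = w ! j" if "j < length u" for j
  proof (rule nth_equalityI)
    show "length (u ! j) = length (w ! j)" using assms(1,2) that by simp
    show "u ! j ! i = w ! j ! i" if "i < length (u ! j)" for i
    proof -
      have "i < d" using assms(2) that \<open>j < length u\<close> by simp
      then show ?thesis using assms(1,3) \<open>j < length u\<close> by (metis nth_map)
    qed
  qed
qed (rule assms(1))

lemma columns_add:
  assumes "\<forall>n\<in>set ns. length (r n) \<le> m"
  shows "columns r (k + m) ns = replicate k (replicate (length ns) None) @ columns r m ns"
proof (rule rows_ext)
  show "length c = length ns"
    if "c \<in> set (columns r (k + m) ns) \<union> set (replicate k (replicate (length ns) None) @ columns r m ns)" for c
    using that by (auto dest: length_in_columns split: if_splits)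
  fix i assume i: "i < length ns"
  then have le: "length (r (ns ! i)) \<le> m" using assms by simp
  then have "map (\<lambda>c. c ! i) (columns r (k + m) ns) = pad (k + m) (r (ns ! i))"
    using row_columns[OF i, of r "k + m"] by simp
  then show "map (\<lambda>c. c ! i) (columns r (k + m) ns)
      = map (\<lambda>c. c ! i) (replicate k (replicate (length ns) None) @ columns r m ns)"
    using row_columns[OF i, of r m] le i by (simp add: replicate_append_pad)
qed simp

lemma columns_max_length:
  assumes "\<forall>n\<in>set ns. length (r n) \<le> m"
  shows "columns r m ns
    = replicate (m - max_length r ns) (replicate (length ns) None) @ columns r (max_length r ns) ns"
proof -
  have "max_length r ns \<le> m" using assms by (simp add: max_length_le_iff)
  moreover have "\<forall>n\<in>set ns. length (r n) \<le> max_length r ns"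
    using max_length_le_iff by blast
  ultimately show ?thesis using columns_add[of ns r "max_length r ns" "m - max_length r ns"] by simp
qed

text \<open>Deleting the blanks of a row leaves the bare representation whatever the padding, and
  \<open>r\<close> is injective.\<close>

lemma padded_columns_inj:
  assumes "inj r" and "length ns = length ns'" and "\<forall>n\<in>set ns. length (r n) \<le> m"
    and "\<forall>n\<in>set ns'. length (r n) \<le> m'"
    and "columns r m ns = replicate k (replicate (length ns) None) @ columns r m' ns'"
  shows "ns = ns'"
proof (rule nth_equalityI)
  fix i assume i: "i < length ns"
  have "pad m (r (ns ! i)) = map (\<lambda>c. c ! i) (columns r m ns)"
    using i assms(3) by (simp add: row_columns)
  also have "\<dots> = replicate k None @ pad m' (r (ns' ! i))"
    unfolding assms(5) using i assms(2,4) by (simp add: row_columns)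
  finally have "map Some (r (ns ! i)) = filter (\<lambda>z. z \<noteq> None) (replicate k None @ pad m' (r (ns' ! i)))"
    by (metis filter_pad)
  also have "\<dots> = map Some (r (ns' ! i))"
    using filter_pad[of m' "r (ns' ! i)"] by (simp add: filter_replicate)
  finally show "ns ! i = ns' ! i" using assms(1) by (simp add: inj_eq)
qed (rule assms(2))

text \<open>An \<open>enc\<close> word may be wider than \<open>rep_tuple\<close>, so the regular
  language is first closed under leading blank columns and then pulled back along the restriction to
  the first \<open>d\<close> tracks.\<close>

lemma definable_of_recognizable:
  assumes "inj (rep L prec)" and "recognizable \<Sigma> L prec d Y"
  shows "definable (rep L prec) (\<lambda>e. map e [0..<d] \<in> Y)"
proof -
  let ?r = "rep L prec"
  let ?P = "{replicate k (replicate d None) @ w | k w. w \<in> rep_tuple L prec ` Y}"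
  have Y: "length ns = d" if "ns \<in> Y" for ns
    using assms(2) that unfolding recognizable_def by auto
  have "finite_residuals ?P"
    using assms(2) unfolding recognizable_def
    by (intro finite_residuals_pad) (auto dest: regular_imp_finite_residuals)
  then have "finite_residuals {w. map (\<lambda>c. map c [0..<d]) w \<in> ?P}"
    by (rule finite_residuals_vimage_map)
  moreover have "map (\<lambda>c. map c [0..<d]) (enc ?r m e) \<in> ?P \<longleftrightarrow> map e [0..<d] \<in> Y"
    if e: "\<forall>v. length (?r (e v)) \<le> m" for e m
  proof -
    let ?ns = "map e [0..<d]"
    have cols: "map (\<lambda>c. map c [0..<d]) (enc ?r m e) = columns ?r m ?ns"
      by (simp add: enc_def columns_def comp_def)
    have le: "\<forall>n\<in>set ?ns. length (?r n) \<le> m" using e by auto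
    show ?thesis
    proof
      assume "map (\<lambda>c. map c [0..<d]) (enc ?r m e) \<in> ?P"
      then obtain k ns where ns: "ns \<in> Y"
        "columns ?r m ?ns = replicate k (replicate d None) @ columns ?r (max_length ?r ns) ns"
        unfolding cols rep_tuple_eq_columns by auto
      have "?ns = ns"
        by (rule padded_columns_inj[OF assms(1) _ le])
          (use ns Y in \<open>auto simp: max_length_le_iff[THEN iffD1, OF order_refl]\<close>)
      with ns show "?ns \<in> Y" by simp
    next
      assume "?ns \<in> Y"
      then show "map (\<lambda>c. map c [0..<d]) (enc ?r m e) \<in> ?P"
        unfolding cols using columns_max_length[OF le] by (auto simp: rep_tuple_eq_columns)
    qed
  qed
  ultimately show ?thesis
    unfolding definable_def by (intro exI[of _ "{w. map (\<lambda>c. map c [0..<d]) w \<in> ?P}"]) simp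
qed

text \<open>The language \<open>K\<close> is controlled only on genuine encodings. It is cut down to
  words whose rows are padded representations and whose first column is not entirely blank; these
  are exactly the values of \<open>rep_tuple\<close>.\<close>

lemma recognizable_of_definable:
  assumes "definable (rep L prec) P" and "inj (rep L prec)"
    and "finite_residuals (padded (rep L prec) UNIV)" and "range (rep L prec) \<subseteq> lists \<Sigma>"
    and "Y \<subseteq> {ns. length ns = d}" and "\<And>e. P e \<longleftrightarrow> map e [0..<d] \<in> Y"
  shows "recognizable \<Sigma> L prec d Y"
proof -
  let ?r = "rep L prec"
  have sub: "rep_tuple L prec ` Y \<subseteq> lists (tuple_alph \<Sigma> d)"
  proof -
    have "set (pad m (?r n)) \<subseteq> Some ` \<Sigma> \<union> {None}" for m n
      using assms(4) by (auto simp: pad_def)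
    moreover have "pad (max_length ?r ns) (?r n) ! j \<in> set (pad (max_length ?r ns) (?r n))"
      if "n \<in> set ns" "j < max_length ?r ns" for n ns j
      using that by (intro nth_mem) (simp add: max_length_le_iff[THEN iffD1, OF order_refl])
    ultimately show ?thesis
      using assms(5) by (fastforce simp: rep_tuple_eq_columns columns_def tuple_alph_def)
  qed
  have "finite_residuals (rep_tuple L prec ` Y)"
  \<comment> \<open>With no component there is nothing to copy into the infinitely many tracks; the
    language is then empty or consists of the empty word.\<close>
  proof (cases "d = 0")
    case True
    then have "Y = {} \<or> Y = {[]}" using assms(5) by auto
    then have "rep_tuple L prec ` Y = {} \<or> rep_tuple L prec ` Y = lists {}"
      by (auto simp: rep_tuple_def)
    then show ?thesis
      using finite_residuals_lists finite_residuals_Compl[OF finite_residuals_UNIV]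
      by (metis Compl_UNIV_eq)
  next
    case False
    obtain K where K: "finite_residuals K"
      "\<And>e m. (\<And>v. length (?r (e v)) \<le> m) \<Longrightarrow> (enc ?r m e \<in> K \<longleftrightarrow> P e)"
      using assms(1) unfolding definable_def by metis
    \<comment> \<open>The tracks beyond \<open>d\<close> repeat the last component. This keeps all
      lengths bounded, and \<open>P\<close> looks only at the first \<open>d\<close>
      variables.\<close>
    define h :: "'a option list \<Rightarrow> nat \<Rightarrow> 'a option" where "h c v = c ! min v (d - 1)" for c v
    define env :: "nat list \<Rightarrow> nat \<Rightarrow> nat" where "env ns v = ns ! min v (d - 1)" for ns v
    have env: "map (env ns) [0..<d] = ns" if "length ns = d" for ns
      using that by (auto simp: env_def intro!: nth_equalityI)
    have enc: "map h (columns ?r m ns) \<in> K \<longleftrightarrow> ns \<in> Y"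
      if "length ns = d" "\<forall>n\<in>set ns. length (?r n) \<le> m" for m ns
    proof -
      have "map h (columns ?r m ns) = enc ?r m (env ns)"
        using that(1) False by (auto simp: columns_def enc_def h_def env_def fun_eq_iff)
      moreover have "length (?r (env ns v)) \<le> m" for v
        using that False by (simp add: env_def)
      ultimately show ?thesis using K(2)[of "env ns" m] assms(6) env[OF that(1)] by simp
    qed
    let ?Valid = "(\<Inter>i\<in>{..<d}. {w. map (\<lambda>c. c ! i) w \<in> padded ?r UNIV})
      \<inter> (lists {c. length c = d} \<inter> {w. w = [] \<or> hd w \<noteq> replicate d None})"
    have "rep_tuple L prec ` Y = ?Valid \<inter> {w. map h w \<in> K}"
    proof (intro equalityI subsetI)
      fix w assume "w \<in> rep_tuple L prec ` Y"
      then obtain ns where ns: "ns \<in> Y" "w = columns ?r (max_length ?r ns) ns"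
        by (auto simp: rep_tuple_eq_columns)
      have len: "length ns = d" using ns assms(5) by auto
      have le: "\<forall>n\<in>set ns. length (?r n) \<le> max_length ?r ns"
        using max_length_le_iff by blast
      have "map (\<lambda>c. c ! i) w \<in> padded ?r UNIV" if "i < d" for i
        using that le len ns(2) by (auto simp: row_columns pad_in_padded_iff[OF assms(2)])
      moreover have "w \<in> lists {c. length c = d}"
        using ns(2) len by (auto dest: length_in_columns)
      \<comment> \<open>A blank first column would mean that every representation fits into one
        column less, against the choice of the width as a maximum.\<close>
      moreover have "hd w \<noteq> replicate d None" if "w \<noteq> []"
      proof
        assume hd: "hd w = replicate d None"
        have pos: "0 < max_length ?r ns" using that ns(2) by (metis length_columns length_greater_0_conv)
        have "length (?r n) \<le> max_length ?r ns - 1" if "n \<in> set ns" for n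
        proof -
          from that obtain i where i: "i < d" "n = ns ! i" using len by (metis in_set_conv_nth)
          have "pad (max_length ?r ns) (?r n) ! 0 = w ! 0 ! i"
            using i len pos ns(2) by (simp add: columns_def)
          also have "\<dots> = None" using hd \<open>w \<noteq> []\<close> i by (simp add: hd_conv_nth)
          finally show ?thesis using pad_nth_None le that pos by blast
        qed
        then have "max_length ?r ns \<le> max_length ?r ns - 1" by (simp add: max_length_le_iff)
        then show False using pos by simp
      qed
      moreover have "map h w \<in> K" using enc[OF len le] ns by simp
      ultimately show "w \<in> ?Valid \<inter> {w. map h w \<in> K}" by auto
    next
      fix w assume w: "w \<in> ?Valid \<inter> {w. map h w \<in> K}"
      have "\<exists>n. map (\<lambda>c. c ! i) w = pad (length w) (?r n) \<and> length (?r n) \<le> length w" if "i < d" for i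
      proof -
        have "map (\<lambda>c. c ! i) w \<in> padded ?r UNIV" using w that by auto
        then show ?thesis by (rule padded_eq_pad) (metis length_map)
      qed
      then obtain q where q: "\<And>i. i < d \<Longrightarrow> map (\<lambda>c. c ! i) w = pad (length w) (?r (q i))"
        "\<And>i. i < d \<Longrightarrow> length (?r (q i)) \<le> length w" by metis
      define ns where "ns = map q [0..<d]"
      have len: "length ns = d" and le: "\<forall>n\<in>set ns. length (?r n) \<le> length w"
        using q(2) by (auto simp: ns_def)
      have eq: "w = columns ?r (length w) ns"
      proof (rule rows_ext)
        show "length c = d" if "c \<in> set w \<union> set (columns ?r (length w) ns)" for c
          using that w len by (auto dest: length_in_columns)
        show "map (\<lambda>c. c ! i) w = map (\<lambda>c. c ! i) (columns ?r (length w) ns)" if "i < d" for i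
          using that q row_columns[of i ns ?r "length w"] by (simp add: ns_def)
      qed simp
      have "max_length ?r ns = length w"
      proof (rule ccontr)
        assume "max_length ?r ns \<noteq> length w"
        then have "0 < length w - max_length ?r ns"
          using le by (simp add: max_length_le_iff[symmetric])
        then have "w \<noteq> [] \<and> hd w = replicate d None"
          using eq columns_max_length[OF le] len
          by (metis (no_types, lifting) Nil_is_append_conv hd_append2 hd_replicate less_not_refl3
              replicate_empty)
        then show False using w by auto
      qed
      then have "w = rep_tuple L prec ns" using eq by (simp add: rep_tuple_eq_columns)
      moreover have "ns \<in> Y" using enc[OF len le] eq w by auto
      ultimately show "w \<in> rep_tuple L prec ` Y" by blast
    qed
    moreover have "finite_residuals (?Valid \<inter> {w. map h w \<in> K})"
      by (intro finite_residuals_Int finite_residuals_INT finite_residuals_vimage_map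
          finite_residuals_lists finite_residuals_hd_neq assms(3) K(1)) simp
    ultimately show ?thesis by simp
  qed
  then show ?thesis
    unfolding recognizable_def using assms(5) sub finite_residuals_imp_regular by blast
qed


section \<open>Addable numeration systems\<close>

text \<open>\<open>rep\<close> inverts \<open>rank\<close>, the number of predecessors. Strict
  monotonicity makes \<open>rank\<close> injective, and its range is infinite and downward closed,
  hence everything.\<close>

lemma ANS_rep:
  assumes "ANS \<Sigma> L prec"
  shows inj_rep: "inj (rep L prec)" and range_rep: "range (rep L prec) = L"
proof -
  define rank where "rank w = card {v\<in>L. prec v w}" for w
  have irrefl: "\<And>u. u \<in> L \<Longrightarrow> \<not> prec u u"
    and trans: "\<And>u v w. \<lbrakk>u \<in> L; v \<in> L; w \<in> L; prec u v; prec v w\<rbrakk> \<Longrightarrow> prec u w"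
    and total: "\<And>u v. \<lbrakk>u \<in> L; v \<in> L; u \<noteq> v\<rbrakk> \<Longrightarrow> prec u v \<or> prec v u"
    and fin: "\<And>w. w \<in> L \<Longrightarrow> finite {v\<in>L. prec v w}" and inf: "infinite L"
    using assms unfolding ANS_def by blast+
  have mono: "rank u < rank v" if "u \<in> L" "v \<in> L" "prec u v" for u v
    unfolding rank_def
  proof (rule psubset_card_mono[OF fin[OF that(2)]])
    show "{w \<in> L. prec w u} \<subset> {w \<in> L. prec w v}"
      using that irrefl trans by blast
  qed
  have inj: "inj_on rank L"
    by (rule inj_onI) (metis less_irrefl mono total)
  have "n \<in> rank ` L" for n
  proof -
    have "infinite (rank ` L)" using inf inj by (simp add: finite_image_iff)
    then obtain w where w: "w \<in> L" "n < rank w"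
      by (metis finite_nat_iff_bounded_le imageE linorder_not_le subsetI atMost_iff)
    \<comment> \<open>The predecessors of \<open>w\<close> have distinct ranks below
      \<open>rank w\<close>, and there are exactly \<open>rank w\<close> of them, so no smaller
      value is skipped.\<close>
    have "rank ` {v\<in>L. prec v w} = {..<rank w}"
    proof (rule card_subset_eq)
      show "rank ` {v\<in>L. prec v w} \<subseteq> {..<rank w}" using mono w by auto
      have "inj_on rank {v\<in>L. prec v w}" using inj by (rule inj_on_subset) auto
      then show "card (rank ` {v\<in>L. prec v w}) = card {..<rank w}"
        by (simp add: card_image) (simp add: rank_def)
    qed simp
    then show ?thesis using w by blast
  qed
  then have rep: "rep L prec n \<in> L \<and> rank (rep L prec n) = n" for n
    unfolding rep_def rank_def[symmetric] by (rule_tac theI') (metis imageE inj inj_onD)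
  then show "inj (rep L prec)" by (metis injI)
  show "range (rep L prec) = L"
  proof
    show "L \<subseteq> range (rep L prec)"
      using rep inj by (metis inj_onD rangeI subsetI)
  qed (use rep in blast)
qed

lemma strip_padded:
  assumes "replicate k None @ u \<in> padded r N"
  shows "u \<in> padded r N"
  using assms
proof (induction k)
  case (Suc k)
  then obtain l n where n: "n \<in> N" "None # replicate k None @ u = replicate l None @ map Some (r n)"
    unfolding padded_def by auto
  then obtain l' where "l = Suc l'" by (cases l) auto
  then have "replicate k None @ u \<in> padded r N" using n unfolding padded_def by auto
  then show ?case by (rule Suc.IH)
qed simp

text \<open>The regularity of \<open>L\<close> in padded form: every \<open>n\<close> occurs as
  \<open>0 + n\<close>, so projecting the graph of addition to its third track yields all
  representations.\<close>

lemma finite_residuals_padded_addable: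
  assumes "addable \<Sigma> L prec"
  shows "finite_residuals (padded (rep L prec) UNIV)"
proof -
  let ?r = "rep L prec"
  let ?Y = "{[x, y, x + y] | x y. True}"
  let ?T = "map (\<lambda>c. c ! 2) ` {replicate k (replicate 3 None) @ w | k w. w \<in> rep_tuple L prec ` ?Y}"
  have "finite_residuals (rep_tuple L prec ` ?Y)"
    using assms unfolding addable_def recognizable_def by (blast dest: regular_imp_finite_residuals)
  then have "finite_residuals {w. \<exists>k. replicate k None @ w \<in> ?T}"
    by (intro finite_residuals_strip finite_residuals_image_map finite_residuals_pad)
  moreover have "{w. \<exists>k. replicate k None @ w \<in> ?T} = padded ?r UNIV"
  proof (intro equalityI subsetI)
    fix w assume "w \<in> {w. \<exists>k. replicate k None @ w \<in> ?T}"
    then obtain k l x y where eq: "replicate k None @ w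
        = map (\<lambda>c. c ! 2) (replicate l (replicate 3 None) @ rep_tuple L prec [x, y, x + y])"
      by auto
    let ?ns = "[x, y, x + y]" and ?m = "max_length ?r [x, y, x + y]"
    have le: "length (?r (x + y)) \<le> ?m"
      using max_length_le_iff[of ?r ?ns ?m] by simp
    then have "map (\<lambda>c. c ! 2) (rep_tuple L prec ?ns) = pad ?m (?r (x + y))"
      using row_columns[of 2 ?ns ?r ?m] by (simp add: rep_tuple_eq_columns)
    then have "replicate k None @ w = pad (l + ?m) (?r (x + y))"
      unfolding eq using le by (simp add: replicate_append_pad)
    then have "replicate k None @ w \<in> padded ?r UNIV"
      by (auto simp: padded_def pad_def)
    then show "w \<in> padded ?r UNIV" by (rule strip_padded)
  next
    fix w assume "w \<in> padded ?r UNIV"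
    then obtain n where n: "w = pad (length w) (?r n)" "length (?r n) \<le> length w"
      by (rule padded_eq_pad)
    \<comment> \<open>The word for \<open>0\<close> may be longer than the word for
      \<open>n\<close>; the \<open>M\<close> extra blanks make room for it and are removed by
      stripping.\<close>
    let ?ns = "[0, n, 0 + n]"
    define M where "M = max_length ?r ?ns"
    have "\<forall>k\<in>set ?ns. length (?r k) \<le> M"
      unfolding M_def using max_length_le_iff by blast
    then have le: "\<forall>k\<in>set ?ns. length (?r k) \<le> M + length w" by auto
    have "replicate M None @ w = pad (M + length w) (?r n)"
      using n by (metis replicate_append_pad)
    also have "\<dots> = map (\<lambda>c. c ! 2) (columns ?r (M + length w) ?ns)"
      using row_columns[of 2 ?ns ?r "M + length w"] n(2) by simp
    also have "columns ?r (M + length w) ?ns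
        = replicate (length w) (replicate 3 None) @ rep_tuple L prec ?ns"
      using columns_max_length[OF le] by (simp add: M_def rep_tuple_eq_columns numeral_3_eq_3)
    finally have "replicate M None @ w \<in> ?T" by blast
    then show "w \<in> {w. \<exists>k. replicate k None @ w \<in> ?T}" by blast
  qed
  ultimately show ?thesis by simp
qed

section \<open>First-order predicates on numbers and on letters of the word\<close>

locale addable_coding =
  fixes r :: "nat \<Rightarrow> 'a list"
  assumes finite_residuals_padded: "finite_residuals (padded r UNIV)"
    and definable_add_base: "definable r (\<lambda>e. e 2 = e 0 + e 1)"
begin

lemma definable_add: "definable r (\<lambda>e. e k = e i + e j)"
  using definable_rename[OF definable_add_base, of "\<lambda>v. if v = 0 then i else if v = 1 then j else k"]
  by simp

lemma definable_le: "definable r (\<lambda>e. e i \<le> e j)"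
proof -
  have "definable r (\<lambda>e. \<exists>n. (e(2 := n)) 1 = (e(2 := n)) 0 + (e(2 := n)) 2)"
    by (intro definable_ex[OF definable_add] finite_residuals_padded)
  then have "definable r (\<lambda>e. e 0 \<le> e 1)" by (simp add: le_iff_add)
  from definable_rename[OF this, of "\<lambda>v. if v = 0 then i else j"] show ?thesis by simp
qed

lemma definable_less: "definable r (\<lambda>e. e i < e j)"
  using definable_not[OF definable_le] by (simp add: not_le)

lemma definable_eq: "definable r (\<lambda>e. e i = e j)"
  using definable_conj[OF definable_le definable_le] by (simp add: eq_iff)

end

lemma addable_coding_rep:
  assumes "ANS \<Sigma> L prec" and "addable \<Sigma> L prec"
  shows "addable_coding (rep L prec)"
proof
  show "finite_residuals (padded (rep L prec) UNIV)"
    by (rule finite_residuals_padded_addable[OF assms(2)])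
  have "definable (rep L prec) (\<lambda>e. map e [0..<3] \<in> {[x, y, x + y] | x y. True})"
    using assms definable_of_recognizable[OF inj_rep] unfolding addable_def by blast
  then show "definable (rep L prec) (\<lambda>e. e 2 = e 0 + e 1)" by (simp add: numeral_3_eq_3 numeral_2_eq_2)
qed

locale coded_word = addable_coding r for r :: "nat \<Rightarrow> 'a list" +
  fixes A :: "'b set" and x :: "nat \<Rightarrow> 'b"
  assumes finite_A: "finite A" and x_in_A: "\<And>n. x n \<in> A"
    and definable_letter: "\<And>v b. definable r (\<lambda>e. x (e v) = b)"
begin

lemma definable_letter_add: "definable r (\<lambda>e. x (e i + e j) = b)"
proof -
  have "definable r (\<lambda>e. \<exists>n. (e(2 := n)) 2 = (e(2 := n)) 0 + (e(2 := n)) 1 \<and> x ((e(2 := n)) 2) = b)"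
    by (rule definable_ex[OF definable_conj[OF definable_add definable_letter] finite_residuals_padded])
  then have "definable r (\<lambda>e. x (e 0 + e 1) = b)" by simp
  from definable_rename[OF this, of "\<lambda>v. if v = 0 then i else j"] show ?thesis by simp
qed

text \<open>Agreement is the absence of a disagreeing offset, held in variable 3. Equality of two
  letters is a disjunction over the finite alphabet.\<close>

lemma definable_agree: "definable r (\<lambda>e. \<forall>l<e k. x (e i + l) = x (e j + l))"
proof -
  let ?P = "\<lambda>e. e 3 < e 2 \<and> \<not> (\<exists>b\<in>A. x (e 1 + e 3) = b \<and> x (e 0 + e 3) = b)"
  have "definable r ?P"
    by (intro definable_conj definable_less definable_not definable_bex finite_A definable_letter_add)
  from definable_not[OF definable_ex[OF this finite_residuals_padded, of 3]]
  have "definable r (\<lambda>e. \<forall>l<e 2. x (e 0 + l) = x (e 1 + l))"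
    using x_in_A by simp
  from definable_rename[OF this, of "\<lambda>v. if v = 0 then i else if v = 1 then j else k"]
  show ?thesis by simp
qed

end

text \<open>The automaton also assigns outputs to words outside \<open>L\<close>, hence the
  intersection with \<open>padded ?r UNIV\<close>.\<close>

lemma definable_automatic:
  assumes "ANS \<Sigma> L prec" and "addable \<Sigma> L prec" and "automatic \<Sigma> L prec x"
  shows "definable (rep L prec) (\<lambda>e. x (e v) = b)"
proof -
  let ?r = "rep L prec"
  obtain Q :: "nat set" and q0 \<delta> \<tau> where Q: "finite Q" "q0 \<in> Q" "\<forall>q\<in>Q. \<forall>a\<in>\<Sigma>. \<delta> q a \<in> Q"
    and x: "\<And>n. x n = \<tau> (foldl \<delta> q0 (?r n))"
    using assms(3) unfolding automatic_def by blast
  let ?K = "{replicate k None @ w | k w. w \<in> map Some ` {w \<in> lists \<Sigma>. \<tau> (foldl \<delta> q0 w) = b}}"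
  have "finite_residuals (?K \<inter> padded ?r UNIV)"
    using finite_residuals_automaton[OF Q, of "\<lambda>q. \<tau> q = b"]
    by (intro finite_residuals_Int finite_residuals_pad finite_residuals_image_map
        finite_residuals_padded_addable[OF assms(2)])
  moreover have "?K \<inter> padded ?r UNIV = padded ?r {n. x n = b}"
  proof (intro equalityI subsetI)
    fix w assume "w \<in> ?K \<inter> padded ?r UNIV"
    then obtain k u l n where w: "w = replicate k None @ map Some u" "w = replicate l None @ map Some (?r n)"
      and u: "\<tau> (foldl \<delta> q0 u) = b"
      unfolding padded_def by auto
    have "map Some u = filter (\<lambda>z. z \<noteq> None) w" unfolding w(1) by (simp add: filter_replicate)
    also have "\<dots> = map Some (?r n)" unfolding w(2) by (simp add: filter_replicate)
    finally have "u = ?r n" by simp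
    with w u x show "w \<in> padded ?r {n. x n = b}" unfolding padded_def by auto
  next
    fix w assume "w \<in> padded ?r {n. x n = b}"
    then obtain k n where w: "w = replicate k None @ map Some (?r n)" "x n = b"
      unfolding padded_def by auto
    have "?r n \<in> lists \<Sigma>" using range_rep[OF assms(1)] assms(1) unfolding ANS_def by blast
    moreover have "\<tau> (foldl \<delta> q0 (?r n)) = b" using w(2) x by simp
    ultimately have "map Some (?r n) \<in> map Some ` {w \<in> lists \<Sigma>. \<tau> (foldl \<delta> q0 w) = b}" by simp
    then have "w \<in> ?K" using w(1) by blast
    moreover have "w \<in> padded ?r UNIV" using w(1) unfolding padded_def by blast
    ultimately show "w \<in> ?K \<inter> padded ?r UNIV" ..
  qed
  ultimately have "finite_residuals (padded ?r {n. x n = b})" by simp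
  from definable_track[OF inj_rep[OF assms(1)] this] show ?thesis by simp
qed

section \<open>Winning the game with finitely many choices\<close>

text \<open>Winning is defined through infinite plays only, so a finite history is prolonged by
  letting Bob take an arbitrary offered letter in each later round.\<close>

fun play :: "('b list \<Rightarrow> 'b set) \<Rightarrow> 'b list \<Rightarrow> nat \<Rightarrow> 'b" where
  "play \<sigma> h j = (if j < length h then h ! j else SOME b. b \<in> \<sigma> (map (play \<sigma> h) [0..<j]))"

declare play.simps [simp del]

definition histories :: "('b list \<Rightarrow> 'b set) \<Rightarrow> nat \<Rightarrow> 'b list set" where
  "histories \<sigma> n = {h. length h = n \<and> (\<forall>j<n. h ! j \<in> \<sigma> (take j h))}"

lemma play_nth: "j < length h \<Longrightarrow> play \<sigma> h j = h ! j"
  by (simp add: play.simps)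

lemma play_legal:
  assumes "\<And>h. \<sigma> h \<noteq> {}" and "h \<in> histories \<sigma> n"
  shows "play \<sigma> h j \<in> \<sigma> (map (play \<sigma> h) [0..<j])"
proof (cases "j < length h")
  case True
  then have "map (play \<sigma> h) [0..<j] = take j h"
    by (auto simp: play_nth intro!: nth_equalityI)
  then show ?thesis using True assms(2) by (simp add: play_nth histories_def)
next
  case False
  then have "play \<sigma> h j = (SOME b. b \<in> \<sigma> (map (play \<sigma> h) [0..<j]))" by (simp add: play.simps)
  then show ?thesis using assms(1) by (metis some_in_eq)
qed

lemma play_histories:
  assumes "\<And>h. \<sigma> h \<noteq> {}" and "h \<in> histories \<sigma> n"
  shows "map (play \<sigma> h) [0..<N] \<in> histories \<sigma> N"
proof -
  have "take j (map (play \<sigma> h) [0..<N]) = map (play \<sigma> h) [0..<j]" if "j < N" for j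
    using that by (simp add: take_map)
  then show ?thesis using play_legal[OF assms] by (simp add: histories_def)
qed

lemma histories_Suc: "histories \<sigma> (Suc n) = (\<Union>h\<in>histories \<sigma> n. (\<lambda>b. h @ [b]) ` \<sigma> h)"
proof (intro equalityI subsetI)
  fix h assume h: "h \<in> histories \<sigma> (Suc n)"
  then have len: "length h = Suc n" by (simp add: histories_def)
  then have "h = take n h @ [h ! n]" by (simp add: take_Suc_conv_app_nth[symmetric])
  moreover have "take n h \<in> histories \<sigma> n" "h ! n \<in> \<sigma> (take n h)"
    using h by (auto simp: histories_def)
  ultimately show "h \<in> (\<Union>h\<in>histories \<sigma> n. (\<lambda>b. h @ [b]) ` \<sigma> h)" by blast
next
  fix h assume "h \<in> (\<Union>h\<in>histories \<sigma> n. (\<lambda>b. h @ [b]) ` \<sigma> h)"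
  then show "h \<in> histories \<sigma> (Suc n)"
    by (auto simp: histories_def nth_append less_Suc_eq)
qed

text \<open>Round \<open>n\<close> multiplies the number of histories by
  \<open>\<alpha> n + 1\<close>, which is at most \<open>2 ^ \<alpha> n\<close>. This is the origin
  of the bound \<open>2 ^ d\<close>.\<close>

lemma card_histories:
  assumes "\<And>h. finite (\<sigma> h)" and "\<And>h. card (\<sigma> h) = \<alpha> (length h) + 1"
  shows "finite (histories \<sigma> n) \<and> card (histories \<sigma> n) \<le> 2 ^ (\<Sum>j<n. \<alpha> j)"
proof (induction n)
  case 0
  have "histories \<sigma> 0 = {[]}" by (auto simp: histories_def)
  then show ?case by simp
next
  case (Suc n)
  have "card (histories \<sigma> (Suc n)) \<le> (\<Sum>h\<in>histories \<sigma> n. card ((\<lambda>b. h @ [b]) ` \<sigma> h))"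
    unfolding histories_Suc using Suc by (intro card_UN_le) simp
  also have "\<dots> \<le> (\<Sum>h\<in>histories \<sigma> n. \<alpha> n + 1)"
  proof (rule sum_mono)
    fix h assume "h \<in> histories \<sigma> n"
    then have "card (\<sigma> h) = \<alpha> n + 1" using assms(2) by (simp add: histories_def)
    then show "card ((\<lambda>b. h @ [b]) ` \<sigma> h) \<le> \<alpha> n + 1" using card_image_le[OF assms(1)] by metis
  qed
  also have "\<dots> = card (histories \<sigma> n) * (\<alpha> n + 1)" by simp
  also have "\<dots> \<le> 2 ^ (\<Sum>j<n. \<alpha> j) * 2 ^ \<alpha> n"
    using Suc by (intro mult_mono) (auto simp: Suc_leI)
  finally have "card (histories \<sigma> (Suc n)) \<le> 2 ^ (\<Sum>j<Suc n. \<alpha> j)" by (simp add: power_add)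
  then show ?case using Suc assms(1) by (simp add: histories_Suc)
qed

text \<open>In the tree formed by the shifts of \<open>x\<close> starting in \<open>S\<close>, these
  are the labels of the edges leaving the depth-\<open>m\<close> node on the branch of
  \<open>q\<close>.\<close>

definition next_letters :: "(nat \<Rightarrow> 'b) \<Rightarrow> nat set \<Rightarrow> nat \<Rightarrow> nat \<Rightarrow> 'b set" where
  "next_letters x S q m = {x (q' + m) | q'. q' \<in> S \<and> (\<forall>l<m. x (q + l) = x (q' + l))}"

text \<open>A strategy that leaves a real choice only finitely often is a finite tree, each of whose
  branches can be continued as a shift of the word itself; the starting positions \<open>S\<close> of these
  shifts encode the strategy.\<close>

lemma winning_shift_imp_positions:
  assumes "finite A" and "\<alpha> \<in> winning_shift A (subshift_gen A x)"
    and "\<And>j. N \<le> j \<Longrightarrow> \<alpha> j = 0"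
  obtains S where "finite S" and "S \<noteq> {}" and "card S \<le> 2 ^ (\<Sum>j<N. \<alpha> j)"
    and "\<And>q m. q \<in> S \<Longrightarrow> \<alpha> m \<noteq> 0 \<Longrightarrow> \<alpha> m < card (next_letters x S q m)"
proof -
  obtain \<sigma> where \<sigma>: "\<And>h. \<sigma> h \<subseteq> A" "\<And>h. card (\<sigma> h) = \<alpha> (length h) + 1"
    and win: "\<And>b. (\<And>j. b j \<in> \<sigma> (map b [0..<j])) \<Longrightarrow> b \<in> subshift_gen A x"
    using assms(2) unfolding winning_shift_def by auto
  have fin: "finite (\<sigma> h)" and ne: "\<sigma> h \<noteq> {}" for h
    using \<sigma>[of h] assms(1) finite_subset by auto
  have "\<exists>k. \<forall>i<N. h ! i = x (k + i)" if "h \<in> histories \<sigma> N" for h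
  proof -
    have "play \<sigma> h \<in> subshift_gen A x" using win play_legal[OF ne that] by blast
    then obtain k where "\<forall>i<N. play \<sigma> h i = x (k + i)" unfolding subshift_gen_def by blast
    then show ?thesis using that by (auto simp: histories_def play_nth)
  qed
  then obtain p where p: "\<And>h i. h \<in> histories \<sigma> N \<Longrightarrow> i < N \<Longrightarrow> h ! i = x (p h + i)" by metis
  define S where "S = p ` histories \<sigma> N"
  have card: "finite (histories \<sigma> N)" "card (histories \<sigma> N) \<le> 2 ^ (\<Sum>j<N. \<alpha> j)"
    using card_histories[of \<sigma> \<alpha> N] fin \<sigma>(2) by auto
  show ?thesis
  proof
    show finS: "finite S" unfolding S_def using card by simp
    have "[] \<in> histories \<sigma> 0" by (simp add: histories_def)
    from play_histories[OF ne this] show "S \<noteq> {}" unfolding S_def by blast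
    show "card S \<le> 2 ^ (\<Sum>j<N. \<alpha> j)"
      unfolding S_def using card card_image_le order_trans by blast
    fix q m assume "q \<in> S" and \<alpha>: "\<alpha> m \<noteq> 0"
    then obtain h where h: "h \<in> histories \<sigma> N" "q = p h" unfolding S_def by auto
    have m: "m < N" using assms(3) \<alpha> by (meson not_le)
    have len: "length h = N" using h by (simp add: histories_def)
    \<comment> \<open>Bob may deviate from \<open>h\<close> in round \<open>m\<close> by playing
      \<open>b\<close>. The position chosen for a prolongation of this history agrees with
      \<open>q\<close> on the first \<open>m\<close> letters and then shows
      \<open>b\<close>.\<close>
    have "b \<in> next_letters x S q m" if b: "b \<in> \<sigma> (take m h)" for b
    proof -
      define h' where "h' = map (play \<sigma> (take m h @ [b])) [0..<N]"
      have "take m h @ [b] \<in> histories \<sigma> (Suc m)"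
        using h(1) b m by (auto simp: histories_def nth_append less_Suc_eq)
      from play_histories[OF ne this] have h': "h' \<in> histories \<sigma> N" unfolding h'_def .
      have "x (p h' + m) = b"
        using p[OF h' m] m len by (simp add: h'_def play_nth nth_append)
      moreover have "x (q + l) = x (p h' + l)" if "l < m" for l
        using p[OF h', of l] p[OF h(1), of l] that m len h(2)
        by (simp add: h'_def play_nth nth_append)
      ultimately show ?thesis unfolding next_letters_def S_def using h' by blast
    qed
    then have "card (\<sigma> (take m h)) \<le> card (next_letters x S q m)"
      using finS by (intro card_mono) (auto simp: next_letters_def)
    then show "\<alpha> m < card (next_letters x S q m)" using \<sigma>(2)[of "take m h"] m len by simp
  qed
qed

text \<open>Alice offers only letters that keep the history a prefix of some shift starting in
  \<open>S\<close>. That position may change from round to round, which is harmless since the orbit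
  closure tests prefixes one at a time.\<close>

lemma positions_imp_winning_shift:
  assumes "finite A" and xA: "\<And>n. x n \<in> A" and "S \<noteq> {}"
    and choice: "\<And>q m. q \<in> S \<Longrightarrow> \<alpha> m \<noteq> 0 \<Longrightarrow> \<alpha> m < card (next_letters x S q m)"
  shows "\<alpha> \<in> winning_shift A (subshift_gen A x)"
proof -
  have subA: "next_letters x S q m \<subseteq> A" for q m
    using xA by (auto simp: next_letters_def)
  have less: "\<alpha> m < card (next_letters x S q m)" if "q \<in> S" for q m
  proof (cases "\<alpha> m = 0")
    case True
    have "x (q + m) \<in> next_letters x S q m" using that by (auto simp: next_letters_def)
    then show ?thesis using True subA assms(1) by (metis card_gt_0_iff empty_iff finite_subset)
  qed (use choice that in blast)
  have cardA: "\<alpha> m < card A" for m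
    using less subA assms(1,3) by (metis card_mono ex_in_conv order_less_le_trans)
  define cont where "cont h = {x (q + length h) | q. q \<in> S \<and> (\<forall>l<length h. x (q + l) = h ! l)}" for h
  \<comment> \<open>Histories that follow no position never arise in legal play, but a strategy must
    offer a set of the right size there too; subsets of \<open>A\<close> serve as default.\<close>
  have ex: "\<exists>B. B \<subseteq> (if cont h = {} then A else cont h) \<and> card B = \<alpha> (length h) + 1" for h
  proof (cases "cont h = {}")
    case True
    have "\<alpha> (length h) + 1 \<le> card A" using cardA[of "length h"] by simp
    then obtain B where "B \<subseteq> A" "card B = \<alpha> (length h) + 1" by (rule obtain_subset_with_card_n)
    then show ?thesis using True by auto
  next
    case False
    then obtain q where q: "q \<in> S" "\<forall>l<length h. x (q + l) = h ! l" unfolding cont_def by blast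
    then have "cont h = next_letters x S q (length h)" by (auto simp: cont_def next_letters_def)
    then have "\<alpha> (length h) + 1 \<le> card (cont h)" using less[OF q(1)] by (simp add: Suc_leI)
    then obtain B where "B \<subseteq> cont h" "card B = \<alpha> (length h) + 1" by (rule obtain_subset_with_card_n)
    then show ?thesis using False by auto
  qed
  define \<sigma> where "\<sigma> h = (SOME B. B \<subseteq> (if cont h = {} then A else cont h) \<and> card B = \<alpha> (length h) + 1)" for h
  have \<sigma>: "\<sigma> h \<subseteq> (if cont h = {} then A else cont h) \<and> card (\<sigma> h) = \<alpha> (length h) + 1" for h
    unfolding \<sigma>_def by (rule someI_ex[OF ex])
  have contA: "cont h \<subseteq> A" for h using xA by (auto simp: cont_def)
  have \<sigma>A: "\<sigma> h \<subseteq> A" for h using \<sigma>[of h] contA[of h] by (auto split: if_splits)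
  have "b \<in> subshift_gen A x" if b: "\<forall>j. b j \<in> \<sigma> (map b [0..<j])" for b
  proof -
    have "\<exists>q\<in>S. \<forall>l<n. x (q + l) = b l" for n
    proof (induction n)
      case 0
      then show ?case using assms(3) by auto
    next
      case (Suc n)
      then have "cont (map b [0..<n]) \<noteq> {}" by (auto simp: cont_def)
      then have "b n \<in> cont (map b [0..<n])" using b \<sigma>[of "map b [0..<n]"] by auto
      then obtain q where "q \<in> S" "b n = x (q + n)" "\<forall>l<n. x (q + l) = b l"
        by (auto simp: cont_def)
      then show ?case by (auto simp: less_Suc_eq)
    qed
    then have "\<exists>k. \<forall>i<n. b i = x (k + i)" for n by metis
    moreover have "b j \<in> A" for j using b \<sigma>A by blast
    ultimately show ?thesis unfolding subshift_gen_def by blast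
  qed
  then show ?thesis using cardA \<sigma> \<sigma>A unfolding winning_shift_def by blast
qed


text \<open>Lets a fixed number of variables name a possibly smaller set: surplus indices repeat an
  element.\<close>

lemma card_le_image_lessThan:
  assumes "finite S" and "S \<noteq> {}" and "card S \<le> n"
  obtains f where "S = f ` {..<n}"
proof -
  obtain g where g: "S = g ` {..<card S}"
    using assms(1) by (metis bij_betw_imp_surj_on ex_bij_betw_nat_finite lessThan_atLeast0)
  obtain s where "s \<in> S" using assms(2) by blast
  define f where "f i = (if i < card S then g i else s)" for i
  have "f ` {..<n} = S"
  proof (intro equalityI subsetI)
    fix y assume "y \<in> f ` {..<n}"
    then show "y \<in> S" using g \<open>s \<in> S\<close> by (auto simp: f_def)
  next
    fix y assume "y \<in> S"
    then obtain i where i: "i < card S" "y = g i" using g by auto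
    then have "y = f i" "i < n" using assms(3) by (simp_all add: f_def)
    then show "y \<in> f ` {..<n}" by blast
  qed
  then show thesis using that by blast
qed

text \<open>Multiplicities vanish off \<open>set ns\<close> and sum to \<open>length ns\<close>. So
  only the entries of the tuple impose conditions, and the number of positions depends on the length
  alone.\<close>

lemma count_in_winning_shift_iff:
  assumes "finite A" and "\<And>n. x n \<in> A"
  shows "count (mset ns) \<in> winning_shift A (subshift_gen A x) \<longleftrightarrow>
    (\<exists>p :: nat \<Rightarrow> nat. \<forall>a<2 ^ length ns. \<forall>m\<in>set ns.
      count (mset ns) m < card (next_letters x (p ` {..<2 ^ length ns}) (p a) m))"
proof
  assume win: "count (mset ns) \<in> winning_shift A (subshift_gen A x)"
  obtain N where N: "\<forall>m\<in>set ns. m < N"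
    using finite_nat_set_iff_bounded by blast
  then have zero: "count (mset ns) j = 0" if "N \<le> j" for j
    using that by (metis count_eq_zero_iff not_le set_mset_mset)
  obtain S where S: "finite S" "S \<noteq> {}" "card S \<le> 2 ^ (\<Sum>j<N. count (mset ns) j)"
    "\<And>q m. q \<in> S \<Longrightarrow> count (mset ns) m \<noteq> 0 \<Longrightarrow> count (mset ns) m < card (next_letters x S q m)"
    using winning_shift_imp_positions[OF assms(1) win zero] by metis
  have "(\<Sum>j<N. count (mset ns) j) = (\<Sum>j\<in>set ns. count (mset ns) j)"
    using N by (intro sum.mono_neutral_right) (auto simp: count_eq_zero_iff)
  also have "\<dots> = length ns"
    using size_multiset_overloaded_eq[of "mset ns"] by simp
  finally have "card S \<le> 2 ^ length ns" using S(3) by simp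
  with S(1,2) obtain p :: "nat \<Rightarrow> nat" where p: "S = p ` {..<2 ^ length ns}"
    by (rule card_le_image_lessThan)
  show "\<exists>p :: nat \<Rightarrow> nat. \<forall>a<2 ^ length ns. \<forall>m\<in>set ns.
      count (mset ns) m < card (next_letters x (p ` {..<2 ^ length ns}) (p a) m)"
    using S(4) p by (intro exI[of _ p]) (auto simp: count_eq_zero_iff)
next
  assume "\<exists>p :: nat \<Rightarrow> nat. \<forall>a<2 ^ length ns. \<forall>m\<in>set ns.
      count (mset ns) m < card (next_letters x (p ` {..<2 ^ length ns}) (p a) m)"
  then obtain p :: "nat \<Rightarrow> nat" where "\<forall>a<2 ^ length ns. \<forall>m\<in>set ns.
      count (mset ns) m < card (next_letters x (p ` {..<2 ^ length ns}) (p a) m)" by blast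
  then show "count (mset ns) \<in> winning_shift A (subshift_gen A x)"
    by (intro positions_imp_winning_shift[OF assms, of "p ` {..<2 ^ length ns}"])
      (auto simp: count_eq_zero_iff lessThan_empty_iff)
qed

section \<open>Codability\<close>

lemma nu_unique: "sorted ns \<Longrightarrow> nu (count (mset ns)) = ns"
  unfolding nu_def
  by (rule the_equality) (simp, metis multiset_eq_iff properties_for_sort)

lemma seq_sum_count: "seq_sum (count (mset ns)) = enat (length ns)"
proof -
  have "{j. count (mset ns) j \<noteq> 0} = set ns" by (auto simp: count_eq_zero_iff)
  then show ?thesis using size_multiset_overloaded_eq[of "mset ns"] by (simp add: seq_sum_def)
qed

lemma finite_sum_eq_count:
  assumes "seq_sum y \<noteq> \<infinity>"
  obtains ns where "sorted ns" and "y = count (mset ns)"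
proof -
  have "finite {j. y j > 0}" using assms by (auto simp: seq_sum_def split: if_splits)
  then have "count (Abs_multiset y) = y" by (simp add: Abs_multiset_inverse)
  then have "y = count (mset (sorted_list_of_multiset (Abs_multiset y)))" by simp
  then show thesis using that sorted_sorted_list_of_multiset by blast
qed

text \<open>Sequences of finite sum are the multiplicity functions of sorted lists, and the sum is
  the length of the list.\<close>

lemma nu_image_eq:
  assumes "i \<le> k"
  shows "{nu y | y. y \<in> Y \<and> seq_sum y \<le> enat k} \<inter> {ns. length ns = i}
    = {ns. length ns = i \<and> sorted ns \<and> count (mset ns) \<in> Y}"
proof (intro equalityI subsetI)
  fix ns assume "ns \<in> {nu y | y. y \<in> Y \<and> seq_sum y \<le> enat k} \<inter> {ns. length ns = i}"
  then obtain y where y: "y \<in> Y" "seq_sum y \<le> enat k" "ns = nu y" "length ns = i" by auto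
  then have "seq_sum y \<noteq> \<infinity>" by (cases "seq_sum y") auto
  then obtain ns' where "sorted ns'" "y = count (mset ns')" by (rule finite_sum_eq_count)
  with y show "ns \<in> {ns. length ns = i \<and> sorted ns \<and> count (mset ns) \<in> Y}"
    by (simp add: nu_unique)
next
  fix ns assume "ns \<in> {ns. length ns = i \<and> sorted ns \<and> count (mset ns) \<in> Y}"
  then have "length ns = i" "ns = nu (count (mset ns))" "count (mset ns) \<in> Y"
    "seq_sum (count (mset ns)) \<le> enat k"
    using assms by (simp_all add: nu_unique seq_sum_count)
  then show "ns \<in> {nu y | y. y \<in> Y \<and> seq_sum y \<le> enat k} \<inter> {ns. length ns = i}" by blast
qed

lemma count_mset_map_upt: "count (mset (map e [0..<d])) m = card {l. l < d \<and> e l = m}"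
proof -
  have "{l. l < d \<and> m = map e [0..<d] ! l} = {l. l < d \<and> e l = m}" by auto
  then show ?thesis unfolding count_mset count_list_eq_length_filter length_filter_conv_card by simp
qed

context coded_word
begin

text \<open>Variables below \<open>d\<close> hold the tuple, those from \<open>d\<close> on the
  positions. Both cardinalities count truths among finitely many definable predicates, indexed by
  \<open>l < d\<close> and by letters; the disjoint sum gathers them for
  \<open>definable_finite_info\<close>.\<close>

lemma definable_next_letters_card:
  "definable r (\<lambda>e. card {l. l < d \<and> e l = e j}
    < card (next_letters x ((\<lambda>c. e (d + c)) ` {..<M}) (e (d + a)) (e j)))"
proof -
  let ?B = "\<lambda>b e. \<exists>c\<in>{..<M}. (\<forall>l<e j. x (e (d + a) + l) = x (e (d + c) + l)) \<and> x (e (d + c) + e j) = b"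
  let ?P = "case_sum (\<lambda>l e. e l = e j) ?B"
  let ?g = "\<lambda>J. card {l. Inl l \<in> J} < card {b. Inr b \<in> J}"
  have "definable r (\<lambda>e. ?g {i \<in> {..<d} <+> A. ?P i e})"
  proof (rule definable_finite_info)
    fix i assume "i \<in> {..<d} <+> A"
    show "definable r (?P i)"
      by (cases i) (auto intro!: definable_eq definable_bex definable_conj definable_agree
          definable_letter_add simp del: lessThan_iff)
  qed (simp add: finite_A)
  moreover have "{l. Inl l \<in> {i \<in> {..<d} <+> A. ?P i e}} = {l. l < d \<and> e l = e j}" for e
    by auto
  moreover have "{b. Inr b \<in> {i \<in> {..<d} <+> A. ?P i e}}
      = next_letters x ((\<lambda>c. e (d + c)) ` {..<M}) (e (d + a)) (e j)" for e
    using x_in_A by (auto simp: next_letters_def)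
  ultimately show ?thesis by (simp only:)
qed

text \<open>The block of \<open>2 ^ d\<close> position variables is quantified at once and lies
  above the tuple variables, so the tuple keeps its values.\<close>

lemma definable_winning:
  "definable r (\<lambda>e. sorted (map e [0..<d]) \<and>
     count (mset (map e [0..<d])) \<in> winning_shift A (subshift_gen A x))"
proof -
  let ?M = "2 ^ d :: nat"
  let ?V = "{d..<d + ?M}"
  define body where "body e \<longleftrightarrow> (\<forall>a\<in>{..<?M}. \<forall>j\<in>{..<d}. card {l. l < d \<and> e l = e j}
    < card (next_letters x ((\<lambda>c. e (d + c)) ` {..<?M}) (e (d + a)) (e j)))" for e
  have "definable r (\<lambda>e. body e)"
    unfolding body_def
  proof (rule definable_ball, simp, rule definable_ball, simp)
    fix a j
    show "definable r (\<lambda>e. card {l. l < d \<and> e l = e j}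
        < card (next_letters x ((\<lambda>c. e (d + c)) ` {..<?M}) (e (d + a)) (e j)))"
      by (rule definable_next_letters_card)
  qed
  then have "definable r (\<lambda>e. \<exists>q. body (\<lambda>v. if v \<in> ?V then q v else e v))"
    using definable_ex_block[of ?V r body] finite_residuals_padded by simp
  moreover have "(\<exists>q. body (\<lambda>v. if v \<in> ?V then q v else e v)) \<longleftrightarrow>
      count (mset (map e [0..<d])) \<in> winning_shift A (subshift_gen A x)" for e
  proof -
    let ?Q = "\<lambda>p. \<forall>a<?M. \<forall>j<d. card {l. l < d \<and> e l = e j}
      < card (next_letters x (p ` {..<?M}) (p a) (e j))"
    have body: "body (\<lambda>v. if v \<in> ?V then q v else e v) \<longleftrightarrow> ?Q (\<lambda>c. q (d + c))" for q
    proof -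
      have "(\<lambda>c. if d + c \<in> ?V then q (d + c) else e (d + c)) ` {..<?M} = (\<lambda>c. q (d + c)) ` {..<?M}"
        by (rule image_cong) auto
      moreover have "{l. l < d \<and> (if l \<in> ?V then q l else e l) = (if j \<in> ?V then q j else e j)}
          = {l. l < d \<and> e l = e j}" if "j < d" for j
        using that by auto
      ultimately show ?thesis unfolding body_def by (simp add: Ball_def)
    qed
    have ball: "(\<forall>j\<in>{0..<d}. R j) \<longleftrightarrow> (\<forall>j<d. R j)" for R by auto
    have "(\<exists>q. body (\<lambda>v. if v \<in> ?V then q v else e v)) \<longleftrightarrow> (\<exists>p. ?Q p)"
    proof
      assume "\<exists>q. body (\<lambda>v. if v \<in> ?V then q v else e v)"
      then obtain q where "?Q (\<lambda>c. q (d + c))" unfolding body by (rule exE)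
      then show "\<exists>p. ?Q p" by (rule exI[where x = "\<lambda>c. q (d + c)"])
    next
      assume "\<exists>p. ?Q p"
      then obtain p where "?Q p" by (rule exE)
      \<comment> \<open>The positions are shifted by \<open>d\<close> to fit the variable block, so
        \<open>p\<close> is put into the form that \<open>body\<close> expects.\<close>
      then have "?Q (\<lambda>c. p (d + c - d))" by simp
      then show "\<exists>q. body (\<lambda>v. if v \<in> ?V then q v else e v)"
        unfolding body by (rule exI[where x = "\<lambda>v. p (v - d)"])
    qed
    also have "(\<exists>p. ?Q p) \<longleftrightarrow> count (mset (map e [0..<d])) \<in> winning_shift A (subshift_gen A x)"
      unfolding count_in_winning_shift_iff[OF finite_A x_in_A] count_mset_map_upt
      by (simp add: ball)
    finally show ?thesis .
  qed
  ultimately have win: "definable r (\<lambda>e. count (mset (map e [0..<d])) \<in> winning_shift A (subshift_gen A x))"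
    by simp
  have "definable r (\<lambda>e. \<forall>j\<in>{..<d}. \<forall>i\<in>{..<j}. e i \<le> e j)"
    by (intro definable_ball definable_le) simp_all
  moreover have "(\<forall>j\<in>{..<d}. \<forall>i\<in>{..<j}. e i \<le> e j) \<longleftrightarrow> sorted (map e [0..<d])" for e :: "nat \<Rightarrow> nat"
    by (auto simp: sorted_wrt_iff_nth_less)
  ultimately show ?thesis using definable_conj win by simp
qed

end

theorem mainTheorem3:
  fixes \<Sigma> :: "'a set" and L :: "'a list set" and prec :: "'a list \<Rightarrow> 'a list \<Rightarrow> bool"
    and A :: "'b set" and x :: "nat \<Rightarrow> 'b"
  assumes "ANS \<Sigma> L prec"
    and "addable \<Sigma> L prec"
    and "finite A" and "\<forall>n. x n \<in> A"
    and "automatic \<Sigma> L prec x"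
  shows "weakly_codable \<Sigma> L prec (winning_shift A (subshift_gen A x))"
proof -
  interpret addable_coding "rep L prec"
    by (rule addable_coding_rep[OF assms(1,2)])
  interpret coded_word "rep L prec" A x
    using assms(3,4) definable_automatic[OF assms(1,2,5)] by unfold_locales auto
  have "range (rep L prec) \<subseteq> lists \<Sigma>"
    using range_rep[OF assms(1)] assms(1) unfolding ANS_def by simp
  then have "recognizable \<Sigma> L prec i
      {ns. length ns = i \<and> sorted ns \<and> count (mset ns) \<in> winning_shift A (subshift_gen A x)}" for i
    by (intro recognizable_of_definable[OF definable_winning[of i] inj_rep[OF assms(1)]
          finite_residuals_padded]) auto
  then show ?thesis unfolding weakly_codable_def by (simp add: nu_image_eq)
qed

end
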